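(* Let $P$ be a principal with initial trust assumptions $\mathsf T_P^0$, local-axiom schema instances $\mathsf{LAS}_P$, and set $\mathsf{TS}$ of says-statements, and let $\ell\in\widehat\Lambda$. If $P\text{ trusts }\langle D,O,\mathsf{sattestor}^*(\ell)\rangle$ is derivable by repeatedly applying modus ponens and $\land$-introduction to the axioms, the instances of the local axiom schemata in $\mathsf{LAS}_P$, the elements of $\mathsf{TS}$, and the elements of $\mathsf T_P^0$, then there is a sequence $\{(D_i,O_i,\ell_i)\}_{i=0}^k$ such that the following conditions hold: 1. $(D_k,O_k,\ell_k)=(D,O,\ell)$; and 2. one of the following holds: (a) $P\text{ trusts }\langle D_0,O_0,\mathsf{sattestor}^*(\ell_0)\rangle\in\mathsf T_P^0$ and $\ell_0\succeq\ell$; or (b) $\mathsf{SATT}^*(D_0,O_0)\in\mathsf{LAS}_P$; or (c) for some $g\in\widehat\Gamma$ and some $\ell_0\succeq\ell$: $\mathsf{DEL}(g,\mathsf{sattestor}^*(\ell_0))\in\mathsf{LAS}_P$ and $P\text{ trusts }\langle D_0,O_0,g\rangle$ is derivable; and 3. for $0\le i<k$: (a) $\ell_i\succeq\ell_{i+1}$; and (b) $P\text{ trusts }\langle D_i,O_i,\mathsf{sattestor}^*(\ell_i)\rangle$ is derivable; and 4. for $1\le i<k$, $P$ can derive $P\text{ trusts }(D_i,O_i)\text{ says }\langle D_{i+1},O_{i+1},\mathsf{sattestor}^*(\widetilde{\ell_{i+1}})\rangle$ for some $\widetilde{\ell_{i+1}}$ such that $\ell_i\succeq\widetilde{\ell_{i+1}}\succeq\ell_{i+1}$;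 and 5. $(D_0,O_0)=(D_1,O_1)$.
   Context: **Labels.** $\widehat\Lambda$ is a set of (sattestor-free) labels with a partial order $\prec$ ($\ell_1\prec\ell_2$: "$\ell_1$ narrows $\ell_2$", "$\ell_2$ broadens $\ell_1$"); $\preceq,\succ,\succeq$ are the derived relations. It contains a distinguished label $\mathsf{bound}$, incomparable to every other label. For every $\ell$ the set $\{\ell':\ell'\succeq\ell\}$ is finite and linearly ordered. $\widehat\Gamma=\widehat\Lambda\cup\{\mathsf{sattestor}(\ell):\ell\in\widehat\Lambda\}\cup\{\mathsf{sattestor}^*(\ell):\ell\in\widehat\Lambda\}$ (formal, distinct expressions). $\ell$'s range over $\widehat\Lambda$, $g$'s over $\widehat\Gamma$. **Language.** $D$ ranges over domain names, $O$ over onion addresses. A principal is an element of a set $\mathcal P$, or $\langle D,O\rangle$, or a pair $(D,O)$. A bound labeled pair is $\langle D,O\rangle$ (synonymous with $\langle D,O,\mathsf{bound}\rangle$) or $\langle D,O,g\rangle$. A says-statement is $(D,O)\text{ says }\pi$, $\pi$ a bound labeled pair. A trust statement is $P\text{ trusts }\chi$, $\chi$ a says-statement or bound labeled pair. Statements are the pairs $\langle D,O\rangle$/$\langle D,O,\mathsf{bound}\rangle$, says-statements, trust statements, and order statements $\ell\preceq\ell'$ (also written $\ell'\succeq\ell$). Formulae are built from statements with $\rightarrow$ and $\land$. **Axioms** (all instances): - A1: $(\ell_1\succeq\ell_2 \land P\text{ trusts }\langle D,O,\ell_2\rangle)\rightarrow P\text{ trusts }\langle D,O,\ell_1\rangle$.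 - A2: $(\ell_1\succeq\ell_2\succeq\ell_3 \land P\text{ trusts }\langle D_1,O_1,\mathsf{sattestor}(\ell_1)\rangle \land P\text{ trusts }(D_1,O_1)\text{ says }\langle D_2,O_2,\ell_2\rangle \land P\text{ trusts }(D_2,O_2)\text{ says }\langle D_2,O_2,\ell_3\rangle)\rightarrow P\text{ trusts }\langle D_2,O_2,\ell_2\rangle$. - A3: $(\ell_1\succeq\ell_2\succeq\ell_3 \land P\text{ trusts }\langle D_1,O_1,\mathsf{sattestor}^*(\ell_1)\rangle \land P\text{ trusts }(D_1,O_1)\text{ says }\langle D_2,O_2,\mathsf{sattestor}^*(\ell_2)\rangle \land P\text{ trusts }(D_2,O_2)\text{ says }\langle D_3,O_3,\mathsf{sattestor}(\ell_3)\rangle)\rightarrow P\text{ trusts }\langle D_2,O_2,\mathsf{sattestor}^*(\ell_3)\rangle$. - A4: $(\ell_1\succeq\ell_2\succeq\ell_3 \land P\text{ trusts }\langle D_1,O_1,\mathsf{sattestor}^*(\ell_1)\rangle \land P\text{ trusts }(D_1,O_1)\text{ says }\langle D_2,O_2,\mathsf{sattestor}(\ell_2)\rangle \land P\text{ trusts }(D_2,O_2)\text{ says }\langle D_3,O_3,\ell_3\rangle)\rightarrow P\text{ trusts }\langle D_2,O_2,\mathsf{sattestor}(\ell_3)\rangle$. - A5: $P\text{ trusts }\langle D,O,g\rangle\rightarrow P\text{ trusts }\langle D,O,\mathsf{bound}\rangle$. - A6: $(P\text{ trusts }(D,O)\text{ says }\varphi)\rightarrow (P\text{ trusts }(D,O)\text{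 says }\langle D,O,\mathsf{bound}\rangle)$. - A7: $P\text{ trusts }\langle D,O,\mathsf{sattestor}^*(\ell)\rangle\rightarrow P\text{ trusts }\langle D,O,\mathsf{sattestor}(\ell)\rangle$. - A8: $P\text{ trusts }(D_1,O_1)\text{ says }\langle D_2,O_2,\mathsf{sattestor}^*(\ell)\rangle\rightarrow P\text{ trusts }(D_1,O_1)\text{ says }\langle D_2,O_2,\mathsf{sattestor}(\ell)\rangle$. - A9: $(\ell_1\succeq\ell_2\land P\text{ trusts }\langle D,O,\mathsf{sattestor}(\ell_1)\rangle)\rightarrow P\text{ trusts }\langle D,O,\mathsf{sattestor}(\ell_2)\rangle$. - A10: $(\ell_1\succeq\ell_2\land P\text{ trusts }\langle D,O,\mathsf{sattestor}^*(\ell_1)\rangle)\rightarrow P\text{ trusts }\langle D,O,\mathsf{sattestor}^*(\ell_2)\rangle$. - A11: $(D,O)\text{ says }\varphi\rightarrow (P\text{ trusts }(D,O)\text{ says }\varphi)$. - A12: (a) $(\varphi\land\psi)\rightarrow\varphi$; (b) $(\varphi\land\psi)\rightarrow(\psi\land\varphi)$; (c) $(\varphi\land(\psi\land\delta))\rightarrow((\varphi\land\psi)\land\delta)$. **Local axiom schemata** for $P$: - $\mathsf{DEL}(g_1,g_2)$: $P\text{ trusts }\langle D,O,g_1\rangle\rightarrow P\text{ trusts }\langle D,O,g_2\rangle$, for the given $g_1,g_2$ and any $D,O$. - $\mathsf{SATT}(D,O)$: $P\text{ trusts }\langle D,O,\mathsf{sattestor}(\ell)\rangle$, for the given $D,O$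 and all labels $\ell$. - $\mathsf{SATT}^*(D,O)$: $P\text{ trusts }\langle D,O,\mathsf{sattestor}^*(\ell)\rangle$, for the given $D,O$ and all labels $\ell$. **Rules.** Modus ponens (from $\varphi$ and $\varphi\rightarrow\psi$ infer $\psi$) and $\land$-introduction (from $\varphi$ and $\psi$ infer $\varphi\land\psi$). **Setting.** $\mathsf T_P^0$ is a set of trust statements of the form $P\text{ trusts }X$; $\mathsf{LAS}_P$ is a set of instances $\mathsf{DEL}(g_1,g_2)$, $\mathsf{SATT}(D,O)$, $\mathsf{SATT}^*(D,O)$; $\mathsf{TS}$ is a set of says-statements. "Derivable" (or "$P$ can derive") always means derivable by modus ponens and $\land$-introduction from the axioms, $\mathsf{LAS}_P$, $\mathsf{TS}$ and $\mathsf T_P^0$, with the true facts $\ell\preceq\ell'$ about the label order also available as assumptions. All elements of these sets are conjunction-free, and derivations are assumed not to contain applications of modus ponens to axiom A12(a). *)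

theory Defs
  imports Main
begin

section \<open>Labels\<close>

text \<open>The order \<open>l1 \<le> l2\<close> reads ``\<open>l1\<close> narrows, or equals, \<open>l2\<close>''. The label \<open>bound\<close> is
  incomparable to every other label.\<close>

class label = order +
  fixes bound :: 'a
  assumes bound_maximal: "bound \<le> l \<Longrightarrow> l = bound"
    and bound_minimal: "l \<le> bound \<Longrightarrow> l = bound"
    and finite_broader: "finite {l'. l \<le> l'}"
    and linear_broader: "l \<le> l1 \<Longrightarrow> l \<le> l2 \<Longrightarrow> l1 \<le> l2 \<or> l2 \<le> l1"

datatype 'l glabel = Lab 'l | Satt 'l | SattStar 'l


section \<open>Language\<close>

text \<open>Domain names, onion addresses and the set of primitive principals are the types
  \<open>'d\<close>, \<open>'o\<close> and \<open>'p\<close>. The letter \<open>On\<close> is used for onion addresses because \<open>O\<close> is relation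
  composition.\<close>

datatype ('p, 'd, 'o) principal =
  Prim 'p
| BoundPrincipal 'd 'o  \<comment> \<open>\<open>\<langle>D, On\<rangle>\<close>\<close>
| PairPrincipal 'd 'o   \<comment> \<open>\<open>(D, On)\<close>\<close>

text \<open>\<open>\<langle>D, On\<rangle>\<close> as a bound labeled pair is \<open>BLP D On (Lab bound)\<close>.\<close>

datatype ('d, 'o, 'l) blp = BLP 'd 'o "'l glabel"

datatype ('d, 'o, 'l) says_stmt = Says 'd 'o "('d, 'o, 'l) blp"

datatype ('d, 'o, 'l) trusted =
  TrustedSays "('d, 'o, 'l) says_stmt"
| TrustedPair "('d, 'o, 'l) blp"

datatype ('p, 'd, 'o, 'l) trust_stmt =
  Trusts "('p, 'd, 'o) principal" "('d, 'o, 'l) trusted"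

text \<open>Among the bound labeled pairs only \<open>\<langle>D, On\<rangle> = \<langle>D, On, bound\<rangle>\<close> is itself a statement.\<close>

datatype ('p, 'd, 'o, 'l) statement =
  PairStmt 'd 'o
| SaysStmt "('d, 'o, 'l) says_stmt"
| TrustStmt "('p, 'd, 'o, 'l) trust_stmt"
| OrderStmt 'l 'l  \<comment> \<open>\<open>OrderStmt l l'\<close> is the formal statement that \<open>l'\<close> broadens or equals \<open>l\<close>\<close>

datatype ('p, 'd, 'o, 'l) formula =
  Atom "('p, 'd, 'o, 'l) statement"
| Imp "('p, 'd, 'o, 'l) formula" "('p, 'd, 'o, 'l) formula"  (infixr "\<^bold>\<longrightarrow>" 25)
| And "('p, 'd, 'o, 'l) formula" "('p, 'd, 'o, 'l) formula"  (infixr "\<^bold>\<and>" 35)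

abbreviation order_fm :: "'l \<Rightarrow> 'l \<Rightarrow> ('p, 'd, 'o, 'l) formula"  (infix "\<succeq>" 50)
  where "l \<succeq> l' \<equiv> Atom (OrderStmt l' l)"

abbreviation says_fm :: "'d \<Rightarrow> 'o \<Rightarrow> ('d, 'o, 'l) blp \<Rightarrow> ('p, 'd, 'o, 'l) formula"
  where "says_fm D On \<pi> \<equiv> Atom (SaysStmt (Says D On \<pi>))"

abbreviation trusts_pair ::
    "('p, 'd, 'o) principal \<Rightarrow> 'd \<Rightarrow> 'o \<Rightarrow> 'l glabel \<Rightarrow> ('p, 'd, 'o, 'l) formula"
  where "trusts_pair P D On g \<equiv> Atom (TrustStmt (Trusts P (TrustedPair (BLP D On g))))"

abbreviation trusts_says ::
    "('p, 'd, 'o) principal \<Rightarrow> 'd \<Rightarrow> 'o \<Rightarrow> ('d, 'o, 'l) blp \<Rightarrow> ('p, 'd, 'o, 'l) formula"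
  where "trusts_says P D On \<pi> \<equiv> Atom (TrustStmt (Trusts P (TrustedSays (Says D On \<pi>))))"


section \<open>Axioms\<close>

text \<open>A chain \<open>l1 \<succeq> l2 \<succeq> l3\<close> abbreviates the conjunction of its two links, and longer conjunctions
  are nested to the right.\<close>

definition conj_elim_axiom :: "('p, 'd, 'o, 'l) formula \<Rightarrow> bool"
  where "conj_elim_axiom \<chi> \<longleftrightarrow> (\<exists>\<phi> \<psi>. \<chi> = (\<phi> \<^bold>\<and> \<psi> \<^bold>\<longrightarrow> \<phi>))"

inductive logic_axiom :: "('p, 'd, 'o, 'l::label) formula \<Rightarrow> bool" where
  A1: "logic_axiom (l1 \<succeq> l2 \<^bold>\<and> trusts_pair P D On (Lab l2) \<^bold>\<longrightarrow> trusts_pair P D On (Lab l1))"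
| A2: "logic_axiom (l1 \<succeq> l2 \<^bold>\<and> l2 \<succeq> l3
        \<^bold>\<and> trusts_pair P D1 On1 (Satt l1)
        \<^bold>\<and> trusts_says P D1 On1 (BLP D2 On2 (Lab l2))
        \<^bold>\<and> trusts_says P D2 On2 (BLP D2 On2 (Lab l3))
      \<^bold>\<longrightarrow> trusts_pair P D2 On2 (Lab l2))"
| A3: "logic_axiom (l1 \<succeq> l2 \<^bold>\<and> l2 \<succeq> l3
        \<^bold>\<and> trusts_pair P D1 On1 (SattStar l1)
        \<^bold>\<and> trusts_says P D1 On1 (BLP D2 On2 (SattStar l2))
        \<^bold>\<and> trusts_says P D2 On2 (BLP D3 On3 (Satt l3))
      \<^bold>\<longrightarrow> trusts_pair P D2 On2 (SattStar l3))"
| A4: "logic_axiom (l1 \<succeq> l2 \<^bold>\<and> l2 \<succeq> l3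
        \<^bold>\<and> trusts_pair P D1 On1 (SattStar l1)
        \<^bold>\<and> trusts_says P D1 On1 (BLP D2 On2 (Satt l2))
        \<^bold>\<and> trusts_says P D2 On2 (BLP D3 On3 (Lab l3))
      \<^bold>\<longrightarrow> trusts_pair P D2 On2 (Satt l3))"
| A5: "logic_axiom (trusts_pair P D On g \<^bold>\<longrightarrow> trusts_pair P D On (Lab bound))"
| A6: "logic_axiom (trusts_says P D On \<pi> \<^bold>\<longrightarrow> trusts_says P D On (BLP D On (Lab bound)))"
| A7: "logic_axiom (trusts_pair P D On (SattStar l) \<^bold>\<longrightarrow> trusts_pair P D On (Satt l))"
| A8: "logic_axiom (trusts_says P D1 On1 (BLP D2 On2 (SattStar l))
      \<^bold>\<longrightarrow> trusts_says P D1 On1 (BLP D2 On2 (Satt l)))"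
| A9: "logic_axiom (l1 \<succeq> l2 \<^bold>\<and> trusts_pair P D On (Satt l1) \<^bold>\<longrightarrow> trusts_pair P D On (Satt l2))"
| A10: "logic_axiom (l1 \<succeq> l2 \<^bold>\<and> trusts_pair P D On (SattStar l1)
      \<^bold>\<longrightarrow> trusts_pair P D On (SattStar l2))"
| A11: "logic_axiom (says_fm D On \<pi> \<^bold>\<longrightarrow> trusts_says P D On \<pi>)"
| A12a: "conj_elim_axiom \<chi> \<Longrightarrow> logic_axiom \<chi>"
| A12b: "logic_axiom (\<phi> \<^bold>\<and> \<psi> \<^bold>\<longrightarrow> \<psi> \<^bold>\<and> \<phi>)"
| A12c: "logic_axiom (\<phi> \<^bold>\<and> (\<psi> \<^bold>\<and> \<delta>) \<^bold>\<longrightarrow> (\<phi> \<^bold>\<and> \<psi>) \<^bold>\<and> \<delta>)"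


section \<open>Local axiom schemata and derivability\<close>

datatype ('d, 'o, 'l) local_schema =
  DEL "'l glabel" "'l glabel"
| SATT 'd 'o
| SATTStar 'd 'o

fun schema_instances ::
    "('p, 'd, 'o) principal \<Rightarrow> ('d, 'o, 'l) local_schema \<Rightarrow> ('p, 'd, 'o, 'l) formula set" where
  "schema_instances P (DEL g1 g2) = {trusts_pair P D On g1 \<^bold>\<longrightarrow> trusts_pair P D On g2 | D On. True}"
| "schema_instances P (SATT D On) = {trusts_pair P D On (Satt l) | l. True}"
| "schema_instances P (SATTStar D On) = {trusts_pair P D On (SattStar l) | l. True}"

text \<open>The elements of \<open>LAS\<close>, \<open>TS\<close> and \<open>T0\<close> are conjunction-free by their types. The side condition
  of \<open>mp\<close> excludes conjunction elimination.\<close>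

inductive derivable ::
    "('p, 'd, 'o) principal \<Rightarrow> ('d, 'o, 'l::label) local_schema set \<Rightarrow>
     ('d, 'o, 'l) says_stmt set \<Rightarrow> ('p, 'd, 'o, 'l) trust_stmt set \<Rightarrow>
     ('p, 'd, 'o, 'l) formula \<Rightarrow> bool"
  for P LAS TS T0 where
  ax: "logic_axiom \<phi> \<Longrightarrow> derivable P LAS TS T0 \<phi>"
| las: "\<sigma> \<in> LAS \<Longrightarrow> \<phi> \<in> schema_instances P \<sigma> \<Longrightarrow> derivable P LAS TS T0 \<phi>"
| ts: "s \<in> TS \<Longrightarrow> derivable P LAS TS T0 (Atom (SaysStmt s))"
| t0: "\<tau> \<in> T0 \<Longrightarrow> derivable P LAS TS T0 (Atom (TrustStmt \<tau>))"
| ord: "l \<ge> l' \<Longrightarrow> derivable P LAS TS T0 (l \<succeq> l')"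
| mp: "derivable P LAS TS T0 \<phi> \<Longrightarrow> derivable P LAS TS T0 (\<phi> \<^bold>\<longrightarrow> \<psi>) \<Longrightarrow>
       \<not> conj_elim_axiom (\<phi> \<^bold>\<longrightarrow> \<psi>) \<Longrightarrow> derivable P LAS TS T0 \<psi>"
| conj_intro: "derivable P LAS TS T0 \<phi> \<Longrightarrow> derivable P LAS TS T0 \<psi> \<Longrightarrow>
       derivable P LAS TS T0 (\<phi> \<^bold>\<and> \<psi>)"

end

(* Without modus ponens on A12(a), a derivable conjunction has only derivable conjuncts and
   every derivable implication is an axiom or a DEL instance. Hence a statement
   "P trusts <D,O,sattestor*(l)>" can only come from T0, SATT*, DEL, A10 or A3. The first three
   start a chain of length one (with (D_0,O_0) = (D_1,O_1)), A10 lowers the last label of a chain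
   and A3 extends a chain by one link. *)

theory Submission
  imports Defs
begin

text \<open>The sequences are total functions on \<open>nat\<close>, constrained only at indices up
  to \<open>k\<close>, so that lengthening or altering a chain is a function update. The bound
  \<open>k \<ge> 1\<close> ensures that index 1 lies on the chain.\<close>

definition delegation_chain ::
    "('p, 'd, 'o) principal \<Rightarrow> ('d, 'o, 'l::label) local_schema set \<Rightarrow>
     ('d, 'o, 'l) says_stmt set \<Rightarrow> ('p, 'd, 'o, 'l) trust_stmt set \<Rightarrow>
     'd \<Rightarrow> 'o \<Rightarrow> 'l \<Rightarrow> nat \<Rightarrow> (nat \<Rightarrow> 'd) \<Rightarrow> (nat \<Rightarrow> 'o) \<Rightarrow> (nat \<Rightarrow> 'l) \<Rightarrow> bool"
  where "delegation_chain P LAS TS T0 D On l k Ds Os ls \<longleftrightarrow>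
    k \<ge> 1
    \<and> (Ds k, Os k, ls k) = (D, On, l)
    \<and> ((Trusts P (TrustedPair (BLP (Ds 0) (Os 0) (SattStar (ls 0)))) \<in> T0 \<and> ls 0 \<ge> l)
       \<or> SATTStar (Ds 0) (Os 0) \<in> LAS
       \<or> (\<exists>g. ls 0 \<ge> l \<and> DEL g (SattStar (ls 0)) \<in> LAS
              \<and> derivable P LAS TS T0 (trusts_pair P (Ds 0) (Os 0) g)))
    \<and> (\<forall>i<k. ls i \<ge> ls (i + 1)
              \<and> derivable P LAS TS T0 (trusts_pair P (Ds i) (Os i) (SattStar (ls i))))
    \<and> (\<forall>i. 1 \<le> i \<and> i < k \<longrightarrow>
         (\<exists>l'. ls i \<ge> l' \<and> l' \<ge> ls (i + 1)
              \<and> derivable P LAS TS T0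
                  (trusts_says P (Ds i) (Os i) (BLP (Ds (i + 1)) (Os (i + 1)) (SattStar l')))))
    \<and> (Ds 0, Os 0) = (Ds 1, Os 1)"

text \<open>For \<open>k = 1\<close> no index satisfies \<open>1 \<le> i < k\<close>, so no
  says-statement is required; the derivability hypothesis serves index 0.\<close>

lemma delegation_chain_single:
  assumes "derivable P LAS TS T0 (trusts_pair P D On (SattStar l))"
    and "Trusts P (TrustedPair (BLP D On (SattStar l))) \<in> T0 \<or> SATTStar D On \<in> LAS
      \<or> (\<exists>g. DEL g (SattStar l) \<in> LAS \<and> derivable P LAS TS T0 (trusts_pair P D On g))"
  shows "delegation_chain P LAS TS T0 D On l 1 (\<lambda>_. D) (\<lambda>_. On) (\<lambda>_. l)"
  using assms by (auto simp: delegation_chain_def)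

text \<open>Since \<open>k \<ge> 1\<close>, the update leaves the start alone, and the derivability
  conditions never mention the label at \<open>k\<close>; the inequalities follow by
  transitivity.\<close>

lemma delegation_chain_lower:
  assumes "delegation_chain P LAS TS T0 D On l k Ds Os ls" and "l' \<le> l"
  shows "delegation_chain P LAS TS T0 D On l' k Ds Os (ls(k := l'))"
proof -
  have less: "ls i \<ge> (ls(k := l')) (i + 1)" if "i < k" for i
    using assms that unfolding delegation_chain_def
    by (metis Pair_inject fun_upd_apply order_trans)
  \<comment> \<open>The old intermediate label still serves: it broadens or equals the old last
    label, hence also the lowered one.\<close>
  have says: "\<exists>m. ls i \<ge> m \<and> m \<ge> (ls(k := l')) (i + 1)
      \<and> derivable P LAS TS T0
          (trusts_says P (Ds i) (Os i) (BLP (Ds (i + 1)) (Os (i + 1)) (SattStar m)))"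
    if "1 \<le> i" "i < k" for i
    using assms that unfolding delegation_chain_def
    by (metis Pair_inject fun_upd_apply order_trans)
  show ?thesis
    using assms less says order_trans[OF assms(2)] unfolding delegation_chain_def
    by auto
qed

text \<open>The old endpoint \<open>k\<close> becomes an interior index, and the two derivability
  hypotheses are what the chain conditions demand there, with \<open>m\<close> as the intermediate
  label.\<close>

lemma delegation_chain_extend:
  assumes chain: "delegation_chain P LAS TS T0 D On l k Ds Os ls"
    and "derivable P LAS TS T0 (trusts_pair P D On (SattStar l))"
    and "derivable P LAS TS T0 (trusts_says P D On (BLP D' On' (SattStar m)))"
    and "l \<ge> m" and "m \<ge> l'"
  shows "delegation_chain P LAS TS T0 D' On' l' (k + 1)
    (Ds(k + 1 := D')) (Os(k + 1 := On')) (ls(k + 1 := l'))"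
proof -
  have le: "l' \<le> l"
    using assms(4,5) by (rule order_trans[rotated])
  show ?thesis
    using assms order_trans[OF le] le unfolding delegation_chain_def
    by (auto simp: less_Suc_eq)
qed

text \<open>Order atoms must be true because chains compare labels in the actual order, while axioms
  only mention formal order statements. The conjunction clause replaces the missing elimination
  rule, and the implication clause records where an implication comes from, so that modus ponens
  becomes a case analysis.\<close>

fun derivation_invariant ::
    "('p, 'd, 'o) principal \<Rightarrow> ('d, 'o, 'l::label) local_schema set \<Rightarrow>
     ('d, 'o, 'l) says_stmt set \<Rightarrow> ('p, 'd, 'o, 'l) trust_stmt set \<Rightarrow>
     ('p, 'd, 'o, 'l) formula \<Rightarrow> bool" where
  "derivation_invariant P LAS TS T0 (Atom s) \<longleftrightarrow>
     derivable P LAS TS T0 (Atom s)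
     \<and> (\<forall>l l'. s = OrderStmt l' l \<longrightarrow> l' \<le> l)
     \<and> (\<forall>D On l. s = TrustStmt (Trusts P (TrustedPair (BLP D On (SattStar l))))
          \<longrightarrow> (\<exists>k Ds Os ls. delegation_chain P LAS TS T0 D On l k Ds Os ls))"
| "derivation_invariant P LAS TS T0 (\<phi> \<^bold>\<and> \<psi>) \<longleftrightarrow>
     derivation_invariant P LAS TS T0 \<phi> \<and> derivation_invariant P LAS TS T0 \<psi>"
| "derivation_invariant P LAS TS T0 (\<phi> \<^bold>\<longrightarrow> \<psi>) \<longleftrightarrow>
     logic_axiom (\<phi> \<^bold>\<longrightarrow> \<psi>)
     \<or> (\<exists>g1 g2. DEL g1 g2 \<in> LAS \<and> (\<phi> \<^bold>\<longrightarrow> \<psi>) \<in> schema_instances P (DEL g1 g2))"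

lemma logic_axiom_invariant:
  "logic_axiom \<phi> \<Longrightarrow> derivation_invariant P LAS TS T0 \<phi>"
  by (cases \<phi>) (auto elim: logic_axiom.cases simp: conj_elim_axiom_def)

lemma schema_instance_invariant:
  assumes "\<sigma> \<in> LAS" and "\<phi> \<in> schema_instances P \<sigma>"
  shows "derivation_invariant P LAS TS T0 \<phi>"
  using assms derivable.las[OF assms, of TS T0] delegation_chain_single[of P LAS TS T0]
  by (cases \<sigma>) (auto, blast+)

lemma modus_ponens_invariant:
  assumes der: "derivable P LAS TS T0 \<psi>"
    and prem: "derivation_invariant P LAS TS T0 \<phi>"
    and imp: "derivation_invariant P LAS TS T0 (\<phi> \<^bold>\<longrightarrow> \<psi>)"
    and no_elim: "\<not> conj_elim_axiom (\<phi> \<^bold>\<longrightarrow> \<psi>)"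
  shows "derivation_invariant P LAS TS T0 \<psi>"
proof -
  from imp consider (axiom) "logic_axiom (\<phi> \<^bold>\<longrightarrow> \<psi>)"
    | (del) g1 g2 D On where "DEL g1 g2 \<in> LAS"
        "\<phi> = trusts_pair P D On g1" "\<psi> = trusts_pair P D On g2"
    by auto
  then show ?thesis
  proof cases
    case axiom
    then show ?thesis
    proof cases
      case (A3 l1 l2 l3 Q D1 On1 D2 On2 D3 On3)
      \<comment> \<open>Axioms are available for every principal \<open>Q\<close>, but the invariant
        asks for a chain only for \<open>P\<close>. The chain ending at \<open>(D1, On1, l1)\<close>
        is extended with \<open>l2\<close> as intermediate label.\<close>
      have "\<exists>k Ds Os ls. delegation_chain P LAS TS T0 D2 On2 l3 k Ds Os ls" if "Q = P"
        using prem that unfolding A3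
        by clarsimp (blast intro: delegation_chain_extend)
      with der A3 show ?thesis by auto
    next
      case (A10 l1 l2 Q D On)
      have "\<exists>k Ds Os ls. delegation_chain P LAS TS T0 D On l2 k Ds Os ls" if "Q = P"
        using prem that unfolding A10
        by clarsimp (blast intro: delegation_chain_lower)
      with der A10 show ?thesis by auto
    \<comment> \<open>The other axioms conclude atoms that require no chain or, for
      \<open>A12b\<close> and \<open>A12c\<close>, regroup conjuncts; \<open>no_elim\<close>
      excludes \<open>A12a\<close>.\<close>
    qed (use der prem no_elim in auto)
  next
    case del
    \<comment> \<open>This makes \<open>g1\<close> the witness for a chain that starts from a
      \<open>DEL\<close> instance.\<close>
    have "derivable P LAS TS T0 (trusts_pair P D On g1)"
      using prem del by simp
    with der del show ?thesis
      by (auto intro!: exI dest: delegation_chain_single)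
  qed
qed

lemma derivable_invariant:
  "derivable P LAS TS T0 \<phi> \<Longrightarrow> derivation_invariant P LAS TS T0 \<phi>"
proof (induction rule: derivable.induct)
  case (t0 \<tau>)
  have "derivable P LAS TS T0 (Atom (TrustStmt \<tau>))"
    using t0 by (rule derivable.t0)
  with t0 show ?case
    by clarsimp (blast intro: delegation_chain_single)
next
  case (mp \<phi> \<psi>)
  then show ?case
    using derivable.mp modus_ponens_invariant by metis
qed (auto intro: logic_axiom_invariant schema_instance_invariant derivable.ts derivable.ord)

theorem mainTheorem6:
  fixes P :: "('p, 'd, 'o) principal"
    and LAS :: "('d, 'o, 'l::label) local_schema set"
    and TS :: "('d, 'o, 'l) says_stmt set"
    and T0 :: "('p, 'd, 'o, 'l) trust_stmt set"
    and D :: 'd and On :: 'o and l :: 'l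
  assumes "\<forall>\<tau>\<in>T0. \<exists>X. \<tau> = Trusts P X"
    and "derivable P LAS TS T0 (trusts_pair P D On (SattStar l))"
  shows "\<exists>(k::nat) (Ds :: nat \<Rightarrow> 'd) (Os :: nat \<Rightarrow> 'o) (ls :: nat \<Rightarrow> 'l).
    k \<ge> 1
    \<and> (Ds k, Os k, ls k) = (D, On, l)
    \<and> ((Trusts P (TrustedPair (BLP (Ds 0) (Os 0) (SattStar (ls 0)))) \<in> T0 \<and> ls 0 \<ge> l)
       \<or> SATTStar (Ds 0) (Os 0) \<in> LAS
       \<or> (\<exists>g. ls 0 \<ge> l \<and> DEL g (SattStar (ls 0)) \<in> LAS
              \<and> derivable P LAS TS T0 (trusts_pair P (Ds 0) (Os 0) g)))
    \<and> (\<forall>i<k. ls i \<ge> ls (i + 1)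
              \<and> derivable P LAS TS T0 (trusts_pair P (Ds i) (Os i) (SattStar (ls i))))
    \<and> (\<forall>i. 1 \<le> i \<and> i < k \<longrightarrow>
         (\<exists>l'. ls i \<ge> l' \<and> l' \<ge> ls (i + 1)
              \<and> derivable P LAS TS T0
                  (trusts_says P (Ds i) (Os i) (BLP (Ds (i + 1)) (Os (i + 1)) (SattStar l')))))
    \<and> (Ds 0, Os 0) = (Ds 1, Os 1)"
proof -
  have "\<exists>k Ds Os ls. delegation_chain P LAS TS T0 D On l k Ds Os ls"
    using derivable_invariant[OF assms(2)] by simp
  then show ?thesis
    unfolding delegation_chain_def .
qed

end
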